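(* Let $D=(F,R,>)$ be a defeasible theory, $\mathcal{M}$ the logic program associated with $D$ (described in the context), and $p$ a literal. Then: (i) $D\vdash +\Delta p$ iff $\mathcal{M}\models_K \mathtt{definitely}(p)$; (ii) $D\vdash -\Delta p$ iff $\mathcal{M}\models_K \neg\mathtt{definitely}(p)$; (iii) $D\vdash +\partial p$ iff $\mathcal{M}\models_K \mathtt{defeasibly}(p)$; (iv) $D\vdash -\partial p$ iff $\mathcal{M}\models_K \neg\mathtt{defeasibly}(p)$.
   Context: Literals are atoms $p$ or negated atoms $\neg p$; for a literal $q$, $\sim q$ is its complement. A defeasible theory $D=(F,R,>)$ consists of a finite set $F$ of literals (facts), a finite set $R$ of propositional rules, and a binary relation $>$ on $R$ whose transitive closure is irreflexive. Each rule $r$ has a unique label, an antecedent $A(r)$ (finite set of literals), a head $C(r)$ (a literal) and a kind: strict ($\to$), defeasible ($\Rightarrow$) or defeater ($\leadsto$). $R_s$: strict rules; $R_{sd}$: strict or defeasible rules; $R[q]$, $R_s[q]$, $R_{sd}[q]$: those with head $q$. A derivation in $D$ is a finite sequence $P(1),\dots,P(n)$ of tagged literals $+\Delta q,-\Delta q,+\partial q,-\partial q$ such that for each $i$ (with $P(1..i)$ the initial segment of length $i$): ($+\Delta$) if $P(i+1)=+\Delta q$ then $q\in F$ or $\exists r\in R_s[q]\,\forall a\in A(r):+\Delta a\in P(1..i)$; ($-\Delta$) if $P(i+1)=-\Delta q$ then $q\notin F$ and $\forall r\in R_s[q]\,\exists a\in A(r): -\Delta a\in P(1..i)$; ($+\partial$)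 if $P(i+1)=+\partial q$ then either $+\Delta q\in P(1..i)$, or: $\exists r\in R_{sd}[q]\,\forall a\in A(r):+\partial a\in P(1..i)$, and $-\Delta\sim q\in P(1..i)$, and for every $s\in R[\sim q]$ either $\exists a\in A(s):-\partial a\in P(1..i)$ or $\exists t\in R_{sd}[q]$ with $t>s$ and $\forall a\in A(t):+\partial a\in P(1..i)$; ($-\partial$) if $P(i+1)=-\partial q$ then $-\Delta q\in P(1..i)$ and either $\forall r\in R_{sd}[q]\,\exists a\in A(r):-\partial a\in P(1..i)$, or $+\Delta\sim q\in P(1..i)$, or $\exists s\in R[\sim q]$ with $\forall a\in A(s):+\partial a\in P(1..i)$ and for every $t\in R_{sd}[q]$ either $\exists a\in A(t):-\partial a\in P(1..i)$ or $t\not> s$. $D\vdash L$ means $L$ occurs in some derivation in $D$. The program $\mathcal{M}$ consists of the clauses (variables $R,S,T$ ranging over rule labels, $X,Y_i,U_i,V_i$ over literals of $D$, $B$ over lists of literals, all $n\ge 0$; $\sim$ is the complement on literals) $\mathtt{supportive\_rule}(R,X,B)\leftarrow\mathtt{strict}(R,X,B)$; $\mathtt{supportive\_rule}(R,X,B)\leftarrow\mathtt{defeasible}(R,X,B)$; $\mathtt{rule}(R,X,B)\leftarrow\mathtt{supportive\_rule}(R,X,B)$; $\mathtt{rule}(R,X,B)\leftarrow\mathtt{defeater}(R,X,B)$; $\mathtt{definitely}(X)\leftarrow\mathtt{fact}(X)$; $\mathtt{definitely}(X)\leftarrow\mathtt{strict}(R,X,[Y_1,\dots,Y_n]),\mathtt{definitely}(Y_1),\dots,\mathtt{definitely}(Y_n)$;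 $\mathtt{defeasibly}(X)\leftarrow\mathtt{definitely}(X)$; $\mathtt{defeasibly}(X)\leftarrow \mathit{not}\ \mathtt{definitely}(\sim X),\mathtt{supportive\_rule}(R,X,[Y_1,\dots,Y_n]),\mathtt{defeasibly}(Y_1),\dots,\mathtt{defeasibly}(Y_n),\mathit{not}\ \mathtt{overruled}(R,X)$; $\mathtt{overruled}(R,X)\leftarrow\mathtt{rule}(S,\sim X,[U_1,\dots,U_n]),\mathtt{defeasibly}(U_1),\dots,\mathtt{defeasibly}(U_n),\mathit{not}\ \mathtt{defeated}(S,\sim X)$; $\mathtt{defeated}(S,\sim X)\leftarrow\mathtt{sup}(T,S),\mathtt{supportive\_rule}(T,X,[V_1,\dots,V_n]),\mathtt{defeasibly}(V_1),\dots,\mathtt{defeasibly}(V_n)$; plus the facts $\mathtt{fact}(p)$ for $p\in F$; $\mathtt{strict}(r,p,[q_1,\dots,q_n])$, $\mathtt{defeasible}(r,p,[q_1,\dots,q_n])$, $\mathtt{defeater}(r,p,[q_1,\dots,q_n])$ for each strict, defeasible, resp. defeater rule $r$ of $R$ with antecedent $\{q_1,\dots,q_n\}$ and head $p$; and $\mathtt{sup}(r_i,r_j)$ whenever $r_i>r_j$. Kunen semantics: truth values $\mathbf t,\mathbf f,\mathbf u$ with Kleene's strong 3-valued logic (a formula is $\mathbf t$ iff every way of replacing the $\mathbf u$ values by $\mathbf t/\mathbf f$ gives true classically, $\mathbf f$ iff its negation is $\mathbf t$, $\mathbf u$ otherwise); $\mathit{not}\ C$ is read as $\neg C$. Define partial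 interpretations: $I_0(a)=\mathbf u$ for all ground atoms $a$; $I_{n+1}(a)=\mathbf t$ iff some ground instance of a clause of $\mathcal{M}$ with head $a$ has body evaluated $\mathbf t$ under $I_n$; $I_{n+1}(a)=\mathbf f$ iff every ground instance of a clause with head $a$ has body evaluated $\mathbf f$ under $I_n$; $I_{n+1}(a)=\mathbf u$ otherwise. $\mathcal{M}\models_K\varphi$ iff $I_n(\varphi)=\mathbf t$ for some finite $n$. *)

theory Defs
  imports Main
begin

section \<open>Defeasible theories\<close>

datatype 'a lit = Pos 'a | Neg 'a

primrec compl :: "'a lit \<Rightarrow> 'a lit" where
  "compl (Pos a) = Neg a"
| "compl (Neg a) = Pos a"

datatype kind = StrictRule | DefeasibleRule | DefeaterRule

datatype ('l, 'a) rule =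
  Rule (label: 'l) (kind: kind) (ante: "'a lit set") (head: "'a lit")

text \<open>A pair \<open>(t, s)\<close> in \<open>superior D\<close> stands for \<open>t > s\<close>.\<close>

record ('l, 'a) dtheory =
  facts :: "'a lit set"
  rules :: "('l, 'a) rule set"
  superior :: "('l, 'a) rule rel"

definition defeasible_theory :: "('l, 'a) dtheory \<Rightarrow> bool" where
  "defeasible_theory D \<longleftrightarrow>
     finite (facts D) \<and>
     finite (rules D) \<and>
     (\<forall>r \<in> rules D. finite (ante r)) \<and>
     inj_on label (rules D) \<and>
     superior D \<subseteq> rules D \<times> rules D \<and>
     acyclic (superior D)"

definition rules_for :: "('l, 'a) dtheory \<Rightarrow> 'a lit \<Rightarrow> ('l, 'a) rule set" where
  "rules_for D q = {r \<in> rules D. head r = q}"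

definition strict_rules_for :: "('l, 'a) dtheory \<Rightarrow> 'a lit \<Rightarrow> ('l, 'a) rule set" where
  "strict_rules_for D q = {r \<in> rules_for D q. kind r = StrictRule}"

definition supportive_rules_for :: "('l, 'a) dtheory \<Rightarrow> 'a lit \<Rightarrow> ('l, 'a) rule set" where
  "supportive_rules_for D q = {r \<in> rules_for D q. kind r \<in> {StrictRule, DefeasibleRule}}"


section \<open>Derivations\<close>

datatype 'a tagged =
    PlusDelta "'a lit"      (\<open>+\<Delta> _\<close> [90] 90)
  | MinusDelta "'a lit"     (\<open>-\<Delta> _\<close> [90] 90)
  | PlusPartial "'a lit"    (\<open>+\<partial> _\<close> [90] 90)
  | MinusPartial "'a lit"   (\<open>-\<partial> _\<close> [90] 90)

text \<open>\<open>justified D S L\<close>: the condition for appending \<open>L\<close> to an initial segment whose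
  set of members is \<open>S\<close>.\<close>

fun justified :: "('l, 'a) dtheory \<Rightarrow> 'a tagged set \<Rightarrow> 'a tagged \<Rightarrow> bool" where
  "justified D S (+\<Delta> q) \<longleftrightarrow>
     q \<in> facts D \<or> (\<exists>r \<in> strict_rules_for D q. \<forall>a \<in> ante r. +\<Delta> a \<in> S)"
| "justified D S (-\<Delta> q) \<longleftrightarrow>
     q \<notin> facts D \<and> (\<forall>r \<in> strict_rules_for D q. \<exists>a \<in> ante r. -\<Delta> a \<in> S)"
| "justified D S (+\<partial> q) \<longleftrightarrow>
     +\<Delta> q \<in> S \<or>
     ((\<exists>r \<in> supportive_rules_for D q. \<forall>a \<in> ante r. +\<partial> a \<in> S) \<and>
      -\<Delta> (compl q) \<in> S \<and>
      (\<forall>s \<in> rules_for D (compl q).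
         (\<exists>a \<in> ante s. -\<partial> a \<in> S) \<or>
         (\<exists>t \<in> supportive_rules_for D q.
            (t, s) \<in> superior D \<and> (\<forall>a \<in> ante t. +\<partial> a \<in> S))))"
| "justified D S (-\<partial> q) \<longleftrightarrow>
     -\<Delta> q \<in> S \<and>
     ((\<forall>r \<in> supportive_rules_for D q. \<exists>a \<in> ante r. -\<partial> a \<in> S) \<or>
      +\<Delta> (compl q) \<in> S \<or>
      (\<exists>s \<in> rules_for D (compl q).
         (\<forall>a \<in> ante s. +\<partial> a \<in> S) \<and>
         (\<forall>t \<in> supportive_rules_for D q.
            (\<exists>a \<in> ante t. -\<partial> a \<in> S) \<or> (t, s) \<notin> superior D)))"

definition derivation :: "('l, 'a) dtheory \<Rightarrow> 'a tagged list \<Rightarrow> bool" where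
  "derivation D P \<longleftrightarrow> (\<forall>i < length P. justified D (set (take i P)) (P ! i))"

definition derives :: "('l, 'a) dtheory \<Rightarrow> 'a tagged \<Rightarrow> bool" (infix \<open>\<turnstile>\<close> 50) where
  "D \<turnstile> L \<longleftrightarrow> (\<exists>P. derivation D P \<and> L \<in> set P)"


section \<open>Ground logic programs and Kunen semantics\<close>

datatype 'b fm = Top | Atom 'b | Not "'b fm" | And "'b fm" "'b fm"

primrec Conj :: "'b fm list \<Rightarrow> 'b fm" where
  "Conj [] = Top"
| "Conj (\<phi> # \<phi>s) = And \<phi> (Conj \<phi>s)"

datatype truth = T | F | U

text \<open>\<open>outcome I \<phi> b\<close>: some way of replacing the value \<open>U\<close> by \<open>T\<close> or \<open>F\<close>, independently at
  each occurrence of an atom, gives \<open>\<phi>\<close> the classical value \<open>b\<close>. Replacing occurrences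
  rather than atoms is what yields Kleene's strong tables (confirmed below), where for
  instance \<open>p \<and> \<not> p\<close> has value \<open>U\<close> when \<open>p\<close> does.\<close>

primrec outcome :: "('b \<Rightarrow> truth) \<Rightarrow> 'b fm \<Rightarrow> bool \<Rightarrow> bool" where
  "outcome I Top b \<longleftrightarrow> b"
| "outcome I (Atom a) b \<longleftrightarrow> I a = U \<or> I a = (if b then T else F)"
| "outcome I (Not \<phi>) b \<longleftrightarrow> outcome I \<phi> (\<not> b)"
| "outcome I (And \<phi> \<psi>) b \<longleftrightarrow>
     (\<exists>b1 b2. outcome I \<phi> b1 \<and> outcome I \<psi> b2 \<and> b = (b1 \<and> b2))"

definition eval :: "('b \<Rightarrow> truth) \<Rightarrow> 'b fm \<Rightarrow> truth" where
  "eval I \<phi> =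
     (if \<forall>b. outcome I \<phi> b \<longrightarrow> b then T
      else if \<forall>b. outcome I (Not \<phi>) b \<longrightarrow> b then F
      else U)"

lemma outcome_exists: "\<exists>b. outcome I \<phi> b"
proof (induction \<phi>)
  case (Atom a)
  then show ?case by (cases "I a") auto
next
  case (Not \<phi>)
  then obtain b where "outcome I \<phi> b" ..
  then have "outcome I (Not \<phi>) (\<not> b)" by simp
  then show ?case ..
qed auto

lemma eval_Top: "eval I Top = T"
  by (simp add: eval_def)

lemma eval_Atom: "eval I (Atom a) = I a"
  by (cases "I a") (auto simp: eval_def)

lemma eval_Not:
  "eval I (Not \<phi>) = (case eval I \<phi> of T \<Rightarrow> F | F \<Rightarrow> T | U \<Rightarrow> U)"
  using outcome_exists[of I \<phi>]
  by (cases "outcome I \<phi> True"; cases "outcome I \<phi> False")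
    (auto simp: eval_def all_bool_eq ex_bool_eq)

lemma eval_And:
  "eval I (And \<phi> \<psi>) =
     (if eval I \<phi> = F \<or> eval I \<psi> = F then F
      else if eval I \<phi> = T \<and> eval I \<psi> = T then T else U)"
  using outcome_exists[of I \<phi>] outcome_exists[of I \<psi>]
  by (cases "outcome I \<phi> True"; cases "outcome I \<phi> False";
      cases "outcome I \<psi> True"; cases "outcome I \<psi> False")
    (auto simp: eval_def all_bool_eq ex_bool_eq)

text \<open>A clause is a head together with the list of conjuncts of its body.\<close>

type_synonym 'b clause = "'b \<times> 'b fm list"

primrec kunen :: "'b clause set \<Rightarrow> nat \<Rightarrow> 'b \<Rightarrow> truth" where
  "kunen M 0 a = U"
| "kunen M (Suc n) a =
     (if \<exists>B. (a, B) \<in> M \<and> eval (kunen M n) (Conj B) = T then T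
      else if \<forall>B. (a, B) \<in> M \<longrightarrow> eval (kunen M n) (Conj B) = F then F
      else U)"

definition kunen_models :: "'b clause set \<Rightarrow> 'b fm \<Rightarrow> bool" (infix \<open>\<Turnstile>\<^sub>K\<close> 50) where
  "M \<Turnstile>\<^sub>K \<phi> \<longleftrightarrow> (\<exists>n. eval (kunen M n) \<phi> = T)"


section \<open>The logic program of a defeasible theory\<close>

datatype ('l, 'a) atm =
    Fact "'a lit"
  | Strict 'l "'a lit" "'a lit list"
  | Defeasible 'l "'a lit" "'a lit list"
  | Defeater 'l "'a lit" "'a lit list"
  | Sup 'l 'l
  | SupportiveRule 'l "'a lit" "'a lit list"
  | AnyRule 'l "'a lit" "'a lit list"
  | Definitely "'a lit"
  | Defeasibly "'a lit"
  | Overruled 'l "'a lit"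
  | Defeated 'l "'a lit"

definition labels :: "('l, 'a) dtheory \<Rightarrow> 'l set" where
  "labels D = label ` rules D"

text \<open>The literals of \<open>D\<close> are those whose atom occurs in \<open>D\<close>; thus they are closed under
  complement.\<close>

definition literals :: "('l, 'a) dtheory \<Rightarrow> 'a lit set" where
  "literals D =
     (let Q = facts D \<union> head ` rules D \<union> (\<Union>r \<in> rules D. ante r) in Q \<union> compl ` Q)"

text \<open>Antecedents are sets, whereas the program stores them as lists; \<open>lst\<close> is the chosen
  way of writing each antecedent \<open>{q\<^sub>1, \<dots>, q\<^sub>n}\<close> as a list \<open>[q\<^sub>1, \<dots>, q\<^sub>n]\<close>.\<close>

definition lists_antecedents ::
  "('l, 'a) dtheory \<Rightarrow> (('l, 'a) rule \<Rightarrow> 'a lit list) \<Rightarrow> bool" where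
  "lists_antecedents D lst \<longleftrightarrow> (\<forall>r \<in> rules D. set (lst r) = ante r)"

text \<open>The set of all ground instances of the clauses of the program.\<close>

inductive_set program ::
  "('l, 'a) dtheory \<Rightarrow> (('l, 'a) rule \<Rightarrow> 'a lit list) \<Rightarrow> ('l, 'a) atm clause set"
  for D lst where
  supportive_strict:
    "\<lbrakk>r \<in> labels D; x \<in> literals D; b \<in> lists (literals D)\<rbrakk> \<Longrightarrow>
     (SupportiveRule r x b, [Atom (Strict r x b)]) \<in> program D lst"
| supportive_defeasible:
    "\<lbrakk>r \<in> labels D; x \<in> literals D; b \<in> lists (literals D)\<rbrakk> \<Longrightarrow>
     (SupportiveRule r x b, [Atom (Defeasible r x b)]) \<in> program D lst"
| rule_supportive:
    "\<lbrakk>r \<in> labels D; x \<in> literals D; b \<in> lists (literals D)\<rbrakk> \<Longrightarrow>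
     (AnyRule r x b, [Atom (SupportiveRule r x b)]) \<in> program D lst"
| rule_defeater:
    "\<lbrakk>r \<in> labels D; x \<in> literals D; b \<in> lists (literals D)\<rbrakk> \<Longrightarrow>
     (AnyRule r x b, [Atom (Defeater r x b)]) \<in> program D lst"
| definitely_fact:
    "x \<in> literals D \<Longrightarrow> (Definitely x, [Atom (Fact x)]) \<in> program D lst"
| definitely_strict:
    "\<lbrakk>r \<in> labels D; x \<in> literals D; ys \<in> lists (literals D)\<rbrakk> \<Longrightarrow>
     (Definitely x,
      Atom (Strict r x ys) # map (\<lambda>y. Atom (Definitely y)) ys) \<in> program D lst"
| defeasibly_definitely:
    "x \<in> literals D \<Longrightarrow> (Defeasibly x, [Atom (Definitely x)]) \<in> program D lst"
| defeasibly_rule: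
    "\<lbrakk>r \<in> labels D; x \<in> literals D; ys \<in> lists (literals D)\<rbrakk> \<Longrightarrow>
     (Defeasibly x,
      [Not (Atom (Definitely (compl x))), Atom (SupportiveRule r x ys)]
      @ map (\<lambda>y. Atom (Defeasibly y)) ys
      @ [Not (Atom (Overruled r x))]) \<in> program D lst"
| overruled:
    "\<lbrakk>r \<in> labels D; s \<in> labels D; x \<in> literals D; us \<in> lists (literals D)\<rbrakk> \<Longrightarrow>
     (Overruled r x,
      [Atom (AnyRule s (compl x) us)]
      @ map (\<lambda>u. Atom (Defeasibly u)) us
      @ [Not (Atom (Defeated s (compl x)))]) \<in> program D lst"
| defeated:
    "\<lbrakk>s \<in> labels D; t \<in> labels D; x \<in> literals D; vs \<in> lists (literals D)\<rbrakk> \<Longrightarrow>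
     (Defeated s (compl x),
      [Atom (Sup t s), Atom (SupportiveRule t x vs)]
      @ map (\<lambda>v. Atom (Defeasibly v)) vs) \<in> program D lst"
| fact_clause:
    "q \<in> facts D \<Longrightarrow> (Fact q, []) \<in> program D lst"
| strict_clause:
    "\<lbrakk>r \<in> rules D; kind r = StrictRule\<rbrakk> \<Longrightarrow>
     (Strict (label r) (head r) (lst r), []) \<in> program D lst"
| defeasible_clause:
    "\<lbrakk>r \<in> rules D; kind r = DefeasibleRule\<rbrakk> \<Longrightarrow>
     (Defeasible (label r) (head r) (lst r), []) \<in> program D lst"
| defeater_clause:
    "\<lbrakk>r \<in> rules D; kind r = DefeaterRule\<rbrakk> \<Longrightarrow>
     (Defeater (label r) (head r) (lst r), []) \<in> program D lst"
| sup_clause: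
    "(r, s) \<in> superior D \<Longrightarrow> (Sup (label r) (label s), []) \<in> program D lst"

end

theory Submission imports Defs begin

text \<open>Both sides are least fixed points that are reached after finitely many steps, and one step of
  one is simulated by boundedly many steps of the other. If \<open>S\<^sub>n\<close> is the set of tagged literals
  that hold in the partial interpretation \<open>I\<^sub>n\<close>, then every member of \<open>S\<^sub>n\<^sub>+\<^sub>1\<close> about a literal of \<open>D\<close> may be appended to a
  derivation whose members comprise the relevant part of \<open>S\<^sub>n\<close>. Conversely, whatever may be appended
  to a derivation with members in \<open>S\<^sub>n\<close>, where \<open>n \<ge> 3\<close>, lies in \<open>S\<^sub>n\<^sub>+\<^sub>3\<close>: three steps settle the
  auxiliary rule atoms, and three more lead from \<open>Defeated\<close> through \<open>Overruled\<close> to \<open>Defeasibly\<close>.\<close>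

section \<open>Derivable tagged literals\<close>

text \<open>Each clause of \<open>justified\<close> tests \<open>S\<close> only for presence.
  Failure is recorded by the explicit tags \<open>-\<Delta>\<close> and \<open>-\<partial>\<close>,
  never by absence from \<open>S\<close>.\<close>

lemma justified_mono: "justified D S L \<Longrightarrow> S \<subseteq> S' \<Longrightarrow> justified D S' L"
  by (cases L; simp) (meson subsetD)+

lemma derivation_Nil: "derivation D []"
  by (simp add: derivation_def)

lemma derivation_snoc:
  "derivation D (P @ [L]) \<longleftrightarrow> derivation D P \<and> justified D (set P) L"
  by (auto simp: derivation_def nth_append less_Suc_eq)

lemma derivation_append:
  "derivation D P \<Longrightarrow> derivation D Q \<Longrightarrow> derivation D (P @ Q)"
proof (induction Q rule: rev_induct)
  case (snoc L Q)
  then have "derivation D (P @ Q)" "justified D (set (P @ Q)) L"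
    by (auto simp: derivation_snoc elim: justified_mono)
  then show ?case by (metis append_assoc derivation_snoc)
qed simp

text \<open>Premises may come from different derivations. Concatenating these with
  \<open>derivation_append\<close> puts finitely many premises into a single one.\<close>

lemma finite_derivable_subset:
  assumes "finite S" "\<And>L. L \<in> S \<Longrightarrow> D \<turnstile> L"
  shows "\<exists>P. derivation D P \<and> S \<subseteq> set P"
  using assms
proof (induction S)
  case empty
  show ?case using derivation_Nil by auto
next
  case (insert L S)
  then obtain P Q where "derivation D P" "S \<subseteq> set P" "derivation D Q" "L \<in> set Q"
    by (metis derives_def insertCI)
  then show ?case by (intro exI[of _ "P @ Q"]) (auto simp: derivation_append)
qed

primrec tagged_lit :: "'a tagged \<Rightarrow> 'a lit" where
  "tagged_lit (+\<Delta> q) = q"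
| "tagged_lit (-\<Delta> q) = q"
| "tagged_lit (+\<partial> q) = q"
| "tagged_lit (-\<partial> q) = q"

lemma finite_tagged_lit_vimage:
  assumes "finite A"
  shows "finite {L. tagged_lit L \<in> A}"
proof (rule finite_subset)
  show "{L. tagged_lit L \<in> A} \<subseteq>
      PlusDelta ` A \<union> MinusDelta ` A \<union> PlusPartial ` A \<union> MinusPartial ` A"
  proof
    fix L assume "L \<in> {L. tagged_lit L \<in> A}"
    then show "L \<in> PlusDelta ` A \<union> MinusDelta ` A \<union> PlusPartial ` A \<union> MinusPartial ` A"
      by (cases L) auto
  qed
qed (use assms in simp)

lemma justified_relevant:
  assumes "justified D S L"
    and W: "tagged_lit L \<in> W" "compl (tagged_lit L) \<in> W" "\<And>r. r \<in> rules D \<Longrightarrow> ante r \<subseteq> W"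
  shows "justified D (S \<inter> {L. tagged_lit L \<in> W}) L"
proof -
  have ante: "a \<in> W"
    if "r \<in> rules_for D q \<or> r \<in> supportive_rules_for D q \<or> r \<in> strict_rules_for D q"
      "a \<in> ante r" for r a q
    using that W(3) by (auto simp: rules_for_def supportive_rules_for_def strict_rules_for_def)
  show ?thesis
    using assms(1) W(1,2) by (cases L; simp) (meson ante)+
qed

text \<open>This makes derivability a closure property and removes sequences from later arguments.
  The set \<open>S\<close> may be infinite: over infinitely many atoms, all literals foreign to the
  theory are false from the first stage on. It is therefore cut down to the finite set
  \<open>S'\<close>, and here the finiteness of the rule set and of the antecedents enters.\<close>

lemma derives_if_justified:
  assumes "defeasible_theory D" "justified D S L" "\<And>L. L \<in> S \<Longrightarrow> D \<turnstile> L"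
  shows "D \<turnstile> L"
proof -
  define W where "W = {tagged_lit L, compl (tagged_lit L)} \<union> (\<Union>r \<in> rules D. ante r)"
  define S' where "S' = S \<inter> {L. tagged_lit L \<in> W}"
  have "finite W" using assms(1) by (simp add: W_def defeasible_theory_def)
  then have "finite S'" by (simp add: S'_def finite_tagged_lit_vimage)
  then obtain P where P: "derivation D P" "S' \<subseteq> set P"
    using finite_derivable_subset[of S' D] assms(3) by (auto simp: S'_def)
  have "justified D S' L" unfolding S'_def
    by (rule justified_relevant[OF assms(2)]) (auto simp: W_def)
  then have "derivation D (P @ [L])"
    using P justified_mono by (metis derivation_snoc)
  then show ?thesis unfolding derives_def by (intro exI[of _ "P @ [L]"]) simp
qed


section \<open>Kunen semantics\<close>

lemma eval_Not_T: "eval I (Not \<phi>) = T \<longleftrightarrow> eval I \<phi> = F"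
  and eval_Not_F: "eval I (Not \<phi>) = F \<longleftrightarrow> eval I \<phi> = T"
  by (cases "eval I \<phi>"; simp add: eval_Not)+

lemma eval_Conj_T: "eval I (Conj B) = T \<longleftrightarrow> (\<forall>\<phi> \<in> set B. eval I \<phi> = T)"
  by (induction B) (auto simp: eval_Top eval_And)

lemma eval_Conj_F: "eval I (Conj B) = F \<longleftrightarrow> (\<exists>\<phi> \<in> set B. eval I \<phi> = F)"
  by (induction B) (auto simp: eval_Top eval_And)

lemma kunen_Suc_T:
  "kunen M (Suc n) a = T \<longleftrightarrow> (\<exists>B. (a, B) \<in> M \<and> (\<forall>\<phi> \<in> set B. eval (kunen M n) \<phi> = T))"
  by (simp add: eval_Conj_T)

lemma kunen_Suc_F:
  "kunen M (Suc n) a = F \<longleftrightarrow> (\<forall>B. (a, B) \<in> M \<longrightarrow> (\<exists>\<phi> \<in> set B. eval (kunen M n) \<phi> = F))"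
  by (simp add: eval_Conj_F eval_Conj_T) (metis truth.distinct(1))

declare kunen.simps(2) [simp del]

text \<open>Kleene's connectives are monotone for the order that puts \<open>U\<close> below the
  incomparable values \<open>T\<close> and \<open>F\<close>. Both values are treated together
  because \<open>Not\<close> exchanges them.\<close>

lemma eval_mono:
  assumes "\<And>a v. I a = v \<Longrightarrow> v \<noteq> U \<Longrightarrow> J a = v"
  shows "(eval I \<phi> = T \<longrightarrow> eval J \<phi> = T) \<and> (eval I \<phi> = F \<longrightarrow> eval J \<phi> = F)"
  by (induction \<phi>) (use assms in \<open>auto simp: eval_Top eval_Atom eval_Not_T eval_Not_F eval_And
      split: if_splits\<close>)

text \<open>Stages only gain information: the first one is \<open>U\<close> everywhere, and by
  \<open>eval_mono\<close> a formula decided at one stage keeps its value at the next.\<close>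

lemma kunen_mono_Suc: "kunen M n a = v \<Longrightarrow> v \<noteq> U \<Longrightarrow> kunen M (Suc n) a = v"
proof (induction n arbitrary: a v)
  case (Suc n)
  have E: "eval (kunen M n) \<phi> = T \<longrightarrow> eval (kunen M (Suc n)) \<phi> = T"
    "eval (kunen M n) \<phi> = F \<longrightarrow> eval (kunen M (Suc n)) \<phi> = F" for \<phi>
    using eval_mono[of "kunen M n" "kunen M (Suc n)" \<phi>] Suc.IH by blast+
  show ?case
  proof (cases v)
    case T
    then show ?thesis using Suc.prems E(1) unfolding T kunen_Suc_T by blast
  next
    case F
    then show ?thesis using Suc.prems E(2) unfolding F kunen_Suc_F by meson
  qed (use Suc.prems in simp)
qed simp

lemma kunen_mono: "m \<le> n \<Longrightarrow> kunen M m a = v \<Longrightarrow> v \<noteq> U \<Longrightarrow> kunen M n a = v"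
  by (induction n rule: dec_induct) (auto intro: kunen_mono_Suc)


section \<open>The program\<close>

lemma compl_compl [simp]: "compl (compl q) = q"
  by (cases q) auto

text \<open>One-point rules for the shapes in which the clauses with a given head appear below: a
  family of bodies over a label and a list, possibly with one further body \<open>c\<close>. The
  last rule moves a condition on the head out of the quantifier over bodies.\<close>

lemma clause_body_quantifiers:
  "(\<exists>B. (\<exists>l \<in> L. \<exists>ys \<in> Y. B = t l ys) \<and> P B) \<longleftrightarrow> (\<exists>l \<in> L. \<exists>ys \<in> Y. P (t l ys))"
  "(\<exists>B. (B = c \<or> (\<exists>l \<in> L. \<exists>ys \<in> Y. B = t l ys)) \<and> P B) \<longleftrightarrow>
    P c \<or> (\<exists>l \<in> L. \<exists>ys \<in> Y. P (t l ys))"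
  "(\<forall>B. (\<exists>l \<in> L. \<exists>ys \<in> Y. B = t l ys) \<longrightarrow> P B) \<longleftrightarrow> (\<forall>l \<in> L. \<forall>ys \<in> Y. P (t l ys))"
  "(\<forall>B. B = c \<or> (\<exists>l \<in> L. \<exists>ys \<in> Y. B = t l ys) \<longrightarrow> P B) \<longleftrightarrow>
    P c \<and> (\<forall>l \<in> L. \<forall>ys \<in> Y. P (t l ys))"
  "(\<forall>B. C \<and> R B \<longrightarrow> P B) \<longleftrightarrow> (C \<longrightarrow> (\<forall>B. R B \<longrightarrow> P B))"
  by blast+

locale listed_theory =
  fixes D :: "('l, 'a) dtheory" and lst :: "('l, 'a) rule \<Rightarrow> 'a lit list"
  assumes theory_D: "defeasible_theory D"
    and lst: "lists_antecedents D lst"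
begin

abbreviation K :: "nat \<Rightarrow> ('l, 'a) atm \<Rightarrow> truth" where
  "K \<equiv> kunen (program D lst)"

lemma K_up: "K n a = T \<Longrightarrow> K (Suc n) a = T" "K n a = F \<Longrightarrow> K (Suc n) a = F"
  by (simp_all add: kunen_mono_Suc)

lemma set_lst: "r \<in> rules D \<Longrightarrow> set (lst r) = ante r"
  using lst by (simp add: lists_antecedents_def)

lemma label_inj: "r \<in> rules D \<Longrightarrow> s \<in> rules D \<Longrightarrow> label r = label s \<longleftrightarrow> r = s"
  using theory_D by (auto simp: defeasible_theory_def dest: inj_onD)

lemma superior_rules: "(t, s) \<in> superior D \<Longrightarrow> t \<in> rules D \<and> s \<in> rules D"
  using theory_D by (auto simp: defeasible_theory_def)

lemma compl_in_literals: "compl q \<in> literals D \<longleftrightarrow> q \<in> literals D"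
proof -
  have "q \<in> literals D \<Longrightarrow> compl q \<in> literals D" for q
    by (force simp: literals_def Let_def)
  from this[of q] this[of "compl q"] show ?thesis by auto
qed

lemma head_in_literals: "r \<in> rules D \<Longrightarrow> head r \<in> literals D"
  and fact_in_literals: "q \<in> facts D \<Longrightarrow> q \<in> literals D"
  and lst_in_literals: "r \<in> rules D \<Longrightarrow> lst r \<in> lists (literals D)"
  and label_in_labels: "r \<in> rules D \<Longrightarrow> label r \<in> labels D"
  using set_lst by (auto simp: literals_def labels_def Let_def)

lemmas in_program = head_in_literals fact_in_literals lst_in_literals label_in_labels

section \<open>The clauses with a given head\<close>

lemma program_Fact: "(Fact q, B) \<in> program D lst \<longleftrightarrow> q \<in> facts D \<and> B = []"
  and program_Strict: "(Strict l q b, B) \<in> program D lst \<longleftrightarrow>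
    (\<exists>r \<in> rules D. kind r = StrictRule \<and> label r = l \<and> head r = q \<and> lst r = b \<and> B = [])"
  and program_Defeasible: "(Defeasible l q b, B) \<in> program D lst \<longleftrightarrow>
    (\<exists>r \<in> rules D. kind r = DefeasibleRule \<and> label r = l \<and> head r = q \<and> lst r = b \<and> B = [])"
  and program_Defeater: "(Defeater l q b, B) \<in> program D lst \<longleftrightarrow>
    (\<exists>r \<in> rules D. kind r = DefeaterRule \<and> label r = l \<and> head r = q \<and> lst r = b \<and> B = [])"
  and program_Sup: "(Sup l m, B) \<in> program D lst \<longleftrightarrow>
    (\<exists>r s. (r, s) \<in> superior D \<and> label r = l \<and> label s = m \<and> B = [])"
  by (subst program.simps, simp, blast?)+

lemma program_SupportiveRule: "(SupportiveRule l q b, B) \<in> program D lst \<longleftrightarrow>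
    l \<in> labels D \<and> q \<in> literals D \<and> b \<in> lists (literals D) \<and>
    (B = [Atom (Strict l q b)] \<or> B = [Atom (Defeasible l q b)])"
  and program_AnyRule: "(AnyRule l q b, B) \<in> program D lst \<longleftrightarrow>
    l \<in> labels D \<and> q \<in> literals D \<and> b \<in> lists (literals D) \<and>
    (B = [Atom (SupportiveRule l q b)] \<or> B = [Atom (Defeater l q b)])"
  and program_Definitely: "(Definitely q, B) \<in> program D lst \<longleftrightarrow>
    q \<in> literals D \<and> (B = [Atom (Fact q)] \<or>
      (\<exists>l \<in> labels D. \<exists>ys \<in> lists (literals D).
        B = Atom (Strict l q ys) # map (\<lambda>y. Atom (Definitely y)) ys))"
  and program_Defeasibly: "(Defeasibly q, B) \<in> program D lst \<longleftrightarrow>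
    q \<in> literals D \<and> (B = [Atom (Definitely q)] \<or>
      (\<exists>l \<in> labels D. \<exists>ys \<in> lists (literals D).
        B = [Not (Atom (Definitely (compl q))), Atom (SupportiveRule l q ys)]
          @ map (\<lambda>y. Atom (Defeasibly y)) ys @ [Not (Atom (Overruled l q))]))"
  and program_Overruled: "(Overruled l q, B) \<in> program D lst \<longleftrightarrow>
    l \<in> labels D \<and> q \<in> literals D \<and>
      (\<exists>s \<in> labels D. \<exists>us \<in> lists (literals D).
        B = [Atom (AnyRule s (compl q) us)]
          @ map (\<lambda>u. Atom (Defeasibly u)) us @ [Not (Atom (Defeated s (compl q)))])"
  by (subst program.simps, simp, blast?)+

text \<open>The clause head contains \<open>compl x\<close>, so recovering \<open>x\<close> needs
  injectivity of \<open>compl\<close>. Stating the inversion at \<open>compl q\<close> keeps the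
  body in terms of \<open>q\<close>.\<close>

lemma program_Defeated: "(Defeated s (compl q), B) \<in> program D lst \<longleftrightarrow>
    s \<in> labels D \<and> q \<in> literals D \<and>
      (\<exists>t \<in> labels D. \<exists>vs \<in> lists (literals D).
        B = [Atom (Sup t s), Atom (SupportiveRule t q vs)]
          @ map (\<lambda>v. Atom (Defeasibly v)) vs)"
proof -
  have "x = q" if "compl q = compl x" for x
    using that by (metis compl_compl)
  then show ?thesis
    by (subst program.simps) (simp, blast)
qed

section \<open>Truth values of the rule atoms\<close>

lemmas step = kunen_Suc_T kunen_Suc_F ex_disj_distrib all_conj_distrib eval_Atom eval_Not_T eval_Not_F

text \<open>The intended truth condition of every rule atom. Taking a set of kinds lets one notion
  serve all of them: singletons for the atoms given by program facts, two kinds for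
  \<open>SupportiveRule\<close>, and \<open>UNIV\<close> for \<open>AnyRule\<close>.\<close>

definition has_rule :: "kind set \<Rightarrow> 'l \<Rightarrow> 'a lit \<Rightarrow> 'a lit list \<Rightarrow> bool" where
  "has_rule k l q b \<longleftrightarrow> (\<exists>r \<in> rules_for D q. kind r \<in> k \<and> label r = l \<and> lst r = b)"

lemma has_rule_in_program:
  "has_rule k l q b \<Longrightarrow> l \<in> labels D \<and> q \<in> literals D \<and> b \<in> lists (literals D)"
  using in_program by (fastforce simp: has_rule_def rules_for_def)

text \<open>These atoms occur as heads only of clauses with empty bodies. After one step each is
  therefore true if it has a clause, and vacuously false if it has none.\<close>

lemma K_Suc_Fact: "K (Suc n) (Fact q) = (if q \<in> facts D then T else F)"
  and K_Suc_Strict: "K (Suc n) (Strict l q b) = (if has_rule {StrictRule} l q b then T else F)"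
  and K_Suc_Defeasible:
    "K (Suc n) (Defeasible l q b) = (if has_rule {DefeasibleRule} l q b then T else F)"
  and K_Suc_Defeater:
    "K (Suc n) (Defeater l q b) = (if has_rule {DefeaterRule} l q b then T else F)"
  by (auto simp: step program_Fact program_Strict program_Defeasible program_Defeater
      has_rule_def rules_for_def)

text \<open>Two steps are needed because the clauses consult atoms settled after one. Arguments that
  give no ground instance make the atom false, which agrees with \<open>has_rule\<close> by
  \<open>has_rule_in_program\<close>.\<close>

lemma K_Suc_SupportiveRule:
  "K (Suc (Suc n)) (SupportiveRule l q b) =
    (if has_rule {StrictRule, DefeasibleRule} l q b then T else F)"
proof -
  have "has_rule {StrictRule, DefeasibleRule} l q b \<longleftrightarrow>
      has_rule {StrictRule} l q b \<or> has_rule {DefeasibleRule} l q b"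
    by (auto simp: has_rule_def)
  then show ?thesis
    using has_rule_in_program[of _ l q b]
    by (auto simp: step program_SupportiveRule K_Suc_Strict K_Suc_Defeasible)
qed

lemma K_Suc_AnyRule:
  "K (Suc (Suc (Suc n))) (AnyRule l q b) = (if has_rule UNIV l q b then T else F)"
proof -
  have "has_rule UNIV l q b \<longleftrightarrow>
      has_rule {StrictRule, DefeasibleRule} l q b \<or> has_rule {DefeaterRule} l q b"
    unfolding has_rule_def by (auto intro: kind.exhaust)
  then show ?thesis
    using has_rule_in_program[of _ l q b]
    by (auto simp: step program_AnyRule K_Suc_SupportiveRule K_Suc_Defeater)
qed

lemma K_Suc_Sup:
  "K (Suc n) (Sup l m) =
    (if \<exists>t s. (t, s) \<in> superior D \<and> label t = l \<and> label s = m then T else F)"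
  by (fastforce simp: step program_Sup)

text \<open>The bound 3 comes from \<open>AnyRule\<close>, which depends on
  \<open>SupportiveRule\<close>, which in turn depends on \<open>Strict\<close> and
  \<open>Defeasible\<close>.\<close>

lemma rule_atoms_settled:
  assumes "3 \<le> n"
  shows "K n (Fact q) = (if q \<in> facts D then T else F)"
  "K n (Strict l q b) = (if has_rule {StrictRule} l q b then T else F)"
  "K n (SupportiveRule l q b) = (if has_rule {StrictRule, DefeasibleRule} l q b then T else F)"
  "K n (AnyRule l q b) = (if has_rule UNIV l q b then T else F)"
  "K n (Sup l m) = (if \<exists>t s. (t, s) \<in> superior D \<and> label t = l \<and> label s = m then T else F)"
proof -
  obtain k where n: "n = Suc (Suc (Suc k))"
    using assms by (metis Suc_le_D numeral_3_eq_3 Suc_le_mono)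
  show "K n (Fact q) = (if q \<in> facts D then T else F)"
    "K n (Strict l q b) = (if has_rule {StrictRule} l q b then T else F)"
    "K n (SupportiveRule l q b) = (if has_rule {StrictRule, DefeasibleRule} l q b then T else F)"
    "K n (AnyRule l q b) = (if has_rule UNIV l q b then T else F)"
    "K n (Sup l m) = (if \<exists>t s. (t, s) \<in> superior D \<and> label t = l \<and> label s = m then T else F)"
    unfolding n by (rule K_Suc_Fact K_Suc_Strict K_Suc_SupportiveRule K_Suc_AnyRule K_Suc_Sup)+
qed

text \<open>A value other than \<open>U\<close> persists to stage \<open>n + 3\<close>, where the
  atom is settled. Hence a definite value is correct even at a stage below 3.\<close>

lemma rule_atoms_sound:
  "K n (Fact q) = T \<Longrightarrow> q \<in> facts D"
  "K n (Fact q) = F \<Longrightarrow> q \<notin> facts D"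
  "K n (Strict l q b) = T \<Longrightarrow> has_rule {StrictRule} l q b"
  "K n (Strict l q b) = F \<Longrightarrow> \<not> has_rule {StrictRule} l q b"
  "K n (SupportiveRule l q b) = T \<Longrightarrow> has_rule {StrictRule, DefeasibleRule} l q b"
  "K n (SupportiveRule l q b) = F \<Longrightarrow> \<not> has_rule {StrictRule, DefeasibleRule} l q b"
  "K n (AnyRule l q b) = T \<Longrightarrow> has_rule UNIV l q b"
  "K n (AnyRule l q b) = F \<Longrightarrow> \<not> has_rule UNIV l q b"
  "K n (Sup l m) = T \<Longrightarrow> \<exists>t s. (t, s) \<in> superior D \<and> label t = l \<and> label s = m"
  "K n (Sup l m) = F \<Longrightarrow> \<not> (\<exists>t s. (t, s) \<in> superior D \<and> label t = l \<and> label s = m)"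
  by (drule kunen_mono[OF le_add1[of n 3]]; auto simp: rule_atoms_settled split: if_split_asm; fail)+

section \<open>One-step unfolding of the remaining predicates\<close>

lemma K_Suc_Definitely:
  "K (Suc n) (Definitely q) = T \<longleftrightarrow> q \<in> literals D \<and> (K n (Fact q) = T \<or>
    (\<exists>l \<in> labels D. \<exists>ys \<in> lists (literals D).
      K n (Strict l q ys) = T \<and> (\<forall>y \<in> set ys. K n (Definitely y) = T)))"
  "K (Suc n) (Definitely q) = F \<longleftrightarrow> (q \<in> literals D \<longrightarrow> K n (Fact q) = F \<and>
    (\<forall>l \<in> labels D. \<forall>ys \<in> lists (literals D).
      K n (Strict l q ys) = F \<or> (\<exists>y \<in> set ys. K n (Definitely y) = F)))"
  by (simp add: step program_Definitely clause_body_quantifiers ball_Un bex_Un; blast)+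

lemma K_Suc_Defeasibly:
  "K (Suc n) (Defeasibly q) = T \<longleftrightarrow> q \<in> literals D \<and> (K n (Definitely q) = T \<or>
    (\<exists>l \<in> labels D. \<exists>ys \<in> lists (literals D).
      K n (Definitely (compl q)) = F \<and> K n (SupportiveRule l q ys) = T \<and>
      (\<forall>y \<in> set ys. K n (Defeasibly y) = T) \<and> K n (Overruled l q) = F))"
  "K (Suc n) (Defeasibly q) = F \<longleftrightarrow> (q \<in> literals D \<longrightarrow> K n (Definitely q) = F \<and>
    (\<forall>l \<in> labels D. \<forall>ys \<in> lists (literals D).
      K n (Definitely (compl q)) = T \<or> K n (SupportiveRule l q ys) = F \<or>
      (\<exists>y \<in> set ys. K n (Defeasibly y) = F) \<or> K n (Overruled l q) = T))"
  by (simp add: step program_Defeasibly clause_body_quantifiers ball_Un bex_Un; blast)+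

lemma K_Suc_Overruled:
  "K (Suc n) (Overruled l q) = T \<longleftrightarrow> l \<in> labels D \<and> q \<in> literals D \<and>
    (\<exists>s \<in> labels D. \<exists>us \<in> lists (literals D).
      K n (AnyRule s (compl q) us) = T \<and> (\<forall>u \<in> set us. K n (Defeasibly u) = T) \<and>
      K n (Defeated s (compl q)) = F)"
  "K (Suc n) (Overruled l q) = F \<longleftrightarrow> (l \<in> labels D \<and> q \<in> literals D \<longrightarrow>
    (\<forall>s \<in> labels D. \<forall>us \<in> lists (literals D).
      K n (AnyRule s (compl q) us) = F \<or> (\<exists>u \<in> set us. K n (Defeasibly u) = F) \<or>
      K n (Defeated s (compl q)) = T))"
  by (simp add: step program_Overruled clause_body_quantifiers ball_Un bex_Un; blast)+

lemma K_Suc_Defeated: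
  "K (Suc n) (Defeated s (compl q)) = T \<longleftrightarrow> s \<in> labels D \<and> q \<in> literals D \<and>
    (\<exists>t \<in> labels D. \<exists>vs \<in> lists (literals D).
      K n (Sup t s) = T \<and> K n (SupportiveRule t q vs) = T \<and>
      (\<forall>v \<in> set vs. K n (Defeasibly v) = T))"
  "K (Suc n) (Defeated s (compl q)) = F \<longleftrightarrow> (s \<in> labels D \<and> q \<in> literals D \<longrightarrow>
    (\<forall>t \<in> labels D. \<forall>vs \<in> lists (literals D).
      K n (Sup t s) = F \<or> K n (SupportiveRule t q vs) = F \<or>
      (\<exists>v \<in> set vs. K n (Defeasibly v) = F)))"
  by (simp add: step program_Defeated clause_body_quantifiers ball_Un bex_Un; blast)+

section \<open>Passing between rules and their representation in the program\<close>

lemma strict_has_rule: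
  "r \<in> strict_rules_for D q \<Longrightarrow> has_rule {StrictRule} (label r) q (lst r)"
  and supportive_has_rule:
  "r \<in> supportive_rules_for D q \<Longrightarrow> has_rule {StrictRule, DefeasibleRule} (label r) q (lst r)"
  and any_has_rule: "r \<in> rules_for D q \<Longrightarrow> has_rule UNIV (label r) q (lst r)"
  by (auto simp: has_rule_def strict_rules_for_def supportive_rules_for_def)

lemma has_rule_strict:
  assumes "has_rule {StrictRule} l q b"
  obtains r where "r \<in> strict_rules_for D q" "label r = l" "ante r = set b"
  using assms set_lst by (auto simp: has_rule_def strict_rules_for_def rules_for_def)

lemma has_rule_supportive:
  assumes "has_rule {StrictRule, DefeasibleRule} l q b"
  obtains r where "r \<in> supportive_rules_for D q" "label r = l" "ante r = set b"
  using assms set_lst by (auto simp: has_rule_def supportive_rules_for_def rules_for_def)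

lemma has_rule_any:
  assumes "has_rule UNIV l q b"
  obtains r where "r \<in> rules_for D q" "label r = l" "ante r = set b"
  using assms set_lst by (auto simp: has_rule_def rules_for_def)

lemma set_lst_for:
  "r \<in> strict_rules_for D q \<Longrightarrow> set (lst r) = ante r"
  "r \<in> supportive_rules_for D q \<Longrightarrow> set (lst r) = ante r"
  "r \<in> rules_for D q \<Longrightarrow> set (lst r) = ante r"
  using set_lst by (auto simp: strict_rules_for_def supportive_rules_for_def rules_for_def)

text \<open>\<open>Sup\<close> relates labels only. Uniqueness of labels is what lets the
  superiority of the rules themselves be read off.\<close>

lemma superior_labels:
  assumes "r \<in> rules_for D q" "s \<in> rules_for D q'"
  shows "(\<exists>r' s'. (r', s') \<in> superior D \<and> label r' = label r \<and> label s' = label s)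
    \<longleftrightarrow> (r, s) \<in> superior D"
  using assms superior_rules label_inj unfolding rules_for_def by blast

lemma supportive_rules_for: "r \<in> supportive_rules_for D q \<Longrightarrow> r \<in> rules_for D q"
  by (simp add: supportive_rules_for_def)


section \<open>From the program to derivations\<close>

lemma Definitely_T_imp:
  assumes "K (Suc n) (Definitely q) = T"
  shows "q \<in> facts D \<or> (\<exists>r \<in> strict_rules_for D q. \<forall>a \<in> ante r. K n (Definitely a) = T)"
  using assms rule_atoms_sound(1,3) has_rule_strict unfolding K_Suc_Definitely by metis

lemma Definitely_F_imp:
  assumes "K (Suc n) (Definitely q) = F"
  shows "q \<notin> facts D \<and> (\<forall>r \<in> strict_rules_for D q. \<exists>a \<in> ante r. K n (Definitely a) = F)"
proof (intro conjI ballI)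
  show "q \<notin> facts D"
    using assms rule_atoms_sound(2) fact_in_literals unfolding K_Suc_Definitely by blast
  fix r assume "r \<in> strict_rules_for D q"
  then show "\<exists>a \<in> ante r. K n (Definitely a) = F"
    using assms rule_atoms_sound(4) strict_has_rule has_rule_in_program set_lst_for(1)
    unfolding K_Suc_Definitely by metis
qed

text \<open>The clause consults the preceding stage, but the result is lifted back to
  \<open>n\<close>. With the same lifting for \<open>Overruled\<close>, one step of
  \<open>Defeasibly\<close> unfolds into facts about \<open>Defeasibly\<close> at a single
  stage.\<close>

lemma Defeated_T_imp:
  assumes "K n (Defeated (label s) q) = T" "s \<in> rules_for D q"
  shows "\<exists>t \<in> supportive_rules_for D (compl q). (t, s) \<in> superior D \<and>
    (\<forall>a \<in> ante t. K n (Defeasibly a) = T)"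
proof (cases n)
  case (Suc m)
  \<comment> \<open>The double complement brings the atom into the form of the clause head.\<close>
  then have "K (Suc m) (Defeated (label s) (compl (compl q))) = T" using assms(1) by simp
  then obtain l vs where l: "K m (Sup l (label s)) = T" "K m (SupportiveRule l (compl q) vs) = T"
    "\<forall>v \<in> set vs. K m (Defeasibly v) = T"
    unfolding K_Suc_Defeated by blast
  from l(2) obtain t where t: "t \<in> supportive_rules_for D (compl q)" "label t = l" "ante t = set vs"
    by (metis has_rule_supportive rule_atoms_sound(5))
  then have "(t, s) \<in> superior D"
    using rule_atoms_sound(9)[OF l(1)] superior_labels[OF supportive_rules_for[OF t(1)] assms(2)] by simp
  then show ?thesis using t l(3) unfolding Suc by (blast intro: K_up)
qed (use assms in simp)

lemma Defeated_F_imp: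
  assumes "K n (Defeated (label s) q) = F" "s \<in> rules_for D q"
    "t \<in> supportive_rules_for D (compl q)" "(t, s) \<in> superior D"
  shows "\<exists>a \<in> ante t. K n (Defeasibly a) = F"
proof (cases n)
  case (Suc m)
  then have F: "K (Suc m) (Defeated (label s) (compl (compl q))) = F" using assms(1) by simp
  have P: "label s \<in> labels D" "label t \<in> labels D" "compl q \<in> literals D"
      "lst t \<in> lists (literals D)"
    using assms(2,3) has_rule_in_program any_has_rule supportive_has_rule by blast+
  \<comment> \<open>The clause instance for \<open>t\<close> has a false body. Its two rule atoms
    describe an existing rule and so are not false, which leaves an antecedent of \<open>t\<close>
    as the false conjunct.\<close>
  have "K m (Sup (label t) (label s)) \<noteq> F"
    using rule_atoms_sound(10) assms(4) by blast
  moreover have "K m (SupportiveRule (label t) (compl q) (lst t)) \<noteq> F"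
    using rule_atoms_sound(6) supportive_has_rule assms(3) by blast
  ultimately have "\<exists>a \<in> set (lst t). K m (Defeasibly a) = F"
    using F P unfolding K_Suc_Defeated by blast
  then show ?thesis
    using set_lst_for(2)[OF assms(3)] unfolding Suc by (blast intro: K_up)
qed (use assms in simp)

lemma Overruled_T_imp:
  assumes "K n (Overruled l q) = T"
  shows "\<exists>s \<in> rules_for D (compl q). (\<forall>a \<in> ante s. K n (Defeasibly a) = T) \<and>
    (\<forall>t \<in> supportive_rules_for D q. (\<exists>a \<in> ante t. K n (Defeasibly a) = F) \<or> (t, s) \<notin> superior D)"
proof (cases n)
  case (Suc m)
  then obtain k us where k: "K m (AnyRule k (compl q) us) = T"
      "\<forall>u \<in> set us. K m (Defeasibly u) = T" "K m (Defeated k (compl q)) = F"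
    using assms unfolding Suc K_Suc_Overruled by blast
  from k(1) obtain s where s: "s \<in> rules_for D (compl q)" "label s = k" "ante s = set us"
    by (metis has_rule_any rule_atoms_sound(7))
  have "\<exists>a \<in> ante t. K m (Defeasibly a) = F"
    if "t \<in> supportive_rules_for D q" "(t, s) \<in> superior D" for t
    using Defeated_F_imp[of m s "compl q" t] k(3) s that by simp
  then show ?thesis using s k(2) unfolding Suc by (blast intro: K_up)
qed (use assms in simp)

text \<open>The assumption on \<open>l\<close> is essential: for anything that is not a label of the
  theory, \<open>Overruled l q\<close> has no clause and is false for no reason concerning
  attackers.\<close>

lemma Overruled_F_imp:
  assumes "K n (Overruled l q) = F" "l \<in> labels D" "s \<in> rules_for D (compl q)"
  shows "(\<exists>a \<in> ante s. K n (Defeasibly a) = F) \<or>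
    (\<exists>t \<in> supportive_rules_for D q. (t, s) \<in> superior D \<and> (\<forall>a \<in> ante t. K n (Defeasibly a) = T))"
proof (cases n)
  case (Suc m)
  have P: "label s \<in> labels D" "q \<in> literals D" "lst s \<in> lists (literals D)"
    using assms(3) has_rule_in_program any_has_rule compl_in_literals by blast+
  have "K m (AnyRule (label s) (compl q) (lst s)) \<noteq> F"
    using rule_atoms_sound(8) any_has_rule assms(3) by blast
  then have "(\<exists>a \<in> set (lst s). K m (Defeasibly a) = F) \<or> K m (Defeated (label s) (compl q)) = T"
    using assms P unfolding Suc K_Suc_Overruled by blast
  then show ?thesis
    using set_lst_for(3)[OF assms(3)] Defeated_T_imp[of m s "compl q"] assms(3)
    unfolding Suc compl_compl by (blast intro: K_up)
qed (use assms in simp)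

section \<open>Tagged literals that hold at a stage\<close>

primrec holds :: "(('l, 'a) atm \<Rightarrow> truth) \<Rightarrow> 'a tagged \<Rightarrow> bool" where
  "holds I (+\<Delta> q) \<longleftrightarrow> I (Definitely q) = T"
| "holds I (-\<Delta> q) \<longleftrightarrow> I (Definitely q) = F"
| "holds I (+\<partial> q) \<longleftrightarrow> I (Defeasibly q) = T"
| "holds I (-\<partial> q) \<longleftrightarrow> I (Defeasibly q) = F"

lemma holds_mono: "holds (K m) L \<Longrightarrow> m \<le> n \<Longrightarrow> holds (K n) L"
  by (cases L) (auto intro: kunen_mono[of m n])

text \<open>The assumption \<open>lit\<close> matters for \<open>-\<partial>\<close>: for a foreign
  literal \<open>q\<close>, \<open>Defeasibly q\<close> is false at stage 1 while
  \<open>Definitely q\<close> is still \<open>U\<close> at stage 0, so \<open>-\<Delta> q\<close>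
  would be missing.\<close>

lemma holds_imp_justified:
  assumes "holds (K (Suc n)) L" and lit: "tagged_lit L \<in> literals D"
  shows "justified D {L. holds (K n) L} L"
proof (cases L)
  case (PlusDelta q)
  then show ?thesis using assms Definitely_T_imp by simp
next
  case (MinusDelta q)
  then show ?thesis using assms Definitely_F_imp by simp
next
  case (PlusPartial q)
  then have "K (Suc n) (Defeasibly q) = T" using assms by simp
  then consider "K n (Definitely q) = T" | l ys where
      "l \<in> labels D" "K n (Definitely (compl q)) = F" "K n (SupportiveRule l q ys) = T"
      "\<forall>y \<in> set ys. K n (Defeasibly y) = T" "K n (Overruled l q) = F"
    unfolding K_Suc_Defeasibly by blast
  then show ?thesis
  proof cases
    case 2
    obtain r where "r \<in> supportive_rules_for D q" "ante r = set ys"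
      using 2(3) by (metis has_rule_supportive rule_atoms_sound(5))
    then show ?thesis
      using 2 Overruled_F_imp[OF 2(5,1)] unfolding PlusPartial by simp blast
  qed (simp add: PlusPartial)
next
  case (MinusPartial q)
  then have F: "K (Suc n) (Defeasibly q) = F" using assms by simp
  have q: "q \<in> literals D" using lit MinusPartial by simp
  from q have Def: "K n (Definitely q) = F" using F K_Suc_Defeasibly by blast
  have "K n (Definitely (compl q)) = T \<or> K n (Overruled (label r) q) = T \<or>
      (\<exists>a \<in> ante r. K n (Defeasibly a) = F)" if r: "r \<in> supportive_rules_for D q" for r
  proof -
    have "K n (SupportiveRule (label r) q (lst r)) \<noteq> F"
      using rule_atoms_sound(6) supportive_has_rule[OF r] by blast
    then show ?thesis
      using F q has_rule_in_program[OF supportive_has_rule[OF r]] set_lst_for(2)[OF r]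
      unfolding K_Suc_Defeasibly by blast
  qed
  \<comment> \<open>If every supportive rule has a false antecedent, the first alternative of
    \<open>-\<partial>\<close> applies. Otherwise a single other rule suffices, since what its
    failure yields, a definite complement or an undefeated attacker, does not depend on that
    rule.\<close>
  then show ?thesis using Def Overruled_T_imp[of n _ q] unfolding MinusPartial by simp blast
qed

lemma derives_not_literal:
  assumes "q \<notin> literals D"
  shows "D \<turnstile> -\<Delta> q" "D \<turnstile> -\<partial> q"
proof -
  have none: "q \<notin> facts D" "rules_for D q = {}"
    using assms head_in_literals fact_in_literals by (auto simp: rules_for_def)
  show minus: "D \<turnstile> -\<Delta> q"
    by (rule derives_if_justified[OF theory_D, of "{}"])
      (use none in \<open>simp_all add: strict_rules_for_def\<close>)
  show "D \<turnstile> -\<partial> q"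
    by (rule derives_if_justified[OF theory_D, of "{-\<Delta> q}"])
      (use none minus in \<open>simp_all add: supportive_rules_for_def\<close>)
qed

text \<open>Induction on the stage; nothing holds at stage 0. For foreign literals only the negative
  tags can hold, and those are derivable outright.\<close>

lemma holds_imp_derives: "holds (K n) L \<Longrightarrow> D \<turnstile> L"
proof (induction n arbitrary: L)
  case 0
  then show ?case by (cases L) auto
next
  case (Suc n)
  show ?case
  proof (cases "tagged_lit L \<in> literals D")
    case True
    then show ?thesis
      using derives_if_justified[OF theory_D holds_imp_justified] Suc by blast
  next
    case False
    then show ?thesis
      using Suc.prems derives_not_literal
      by (cases L) (simp_all add: K_Suc_Definitely(1) K_Suc_Defeasibly(1))
  qed
qed


section \<open>From derivations to the program\<close>

text \<open>From stage 3 on the rule atoms may be replaced by their truth conditions, so a clause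
  step speaks only of rules of the theory and of their antecedents. The following lemmas use this
  for each predicate in turn.\<close>

lemma Definitely_T_if:
  assumes "3 \<le> n"
    and "q \<in> facts D \<or> (\<exists>r \<in> strict_rules_for D q. \<forall>a \<in> ante r. K n (Definitely a) = T)"
  shows "K (Suc n) (Definitely q) = T"
  using assms(2)
proof (elim disjE bexE)
  assume "q \<in> facts D"
  then show ?thesis
    unfolding K_Suc_Definitely rule_atoms_settled[OF assms(1)] using fact_in_literals by simp
next
  fix r assume "r \<in> strict_rules_for D q" "\<forall>a \<in> ante r. K n (Definitely a) = T"
  then show ?thesis
    unfolding K_Suc_Definitely rule_atoms_settled[OF assms(1)]
    using strict_has_rule has_rule_in_program set_lst_for(1) by metis
qed

lemma Definitely_F_if:
  assumes "3 \<le> n" "q \<notin> facts D"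
    and "\<forall>r \<in> strict_rules_for D q. \<exists>a \<in> ante r. K n (Definitely a) = F"
  shows "K (Suc n) (Definitely q) = F"
  unfolding K_Suc_Definitely rule_atoms_settled[OF assms(1)]
  using assms(2,3) has_rule_strict by (metis (full_types))

lemma Defeated_T_if:
  assumes "3 \<le> n" "t \<in> supportive_rules_for D q" "s \<in> rules_for D (compl q)"
    and "(t, s) \<in> superior D" "\<forall>a \<in> ante t. K n (Defeasibly a) = T"
  shows "K (Suc n) (Defeated (label s) (compl q)) = T"
proof -
  have "has_rule {StrictRule, DefeasibleRule} (label t) q (lst t)"
    by (rule supportive_has_rule[OF assms(2)])
  moreover have "label s \<in> labels D"
    using any_has_rule[OF assms(3)] has_rule_in_program by blast
  moreover have "\<exists>r' s'. (r', s') \<in> superior D \<and> label r' = label t \<and> label s' = label s"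
    using assms(4) by blast
  ultimately show ?thesis
    unfolding K_Suc_Defeated rule_atoms_settled[OF assms(1)]
    using assms(5) has_rule_in_program set_lst_for(2)[OF assms(2)] by metis
qed

text \<open>A clause instance in which no rule atom is false comes from an actual rule
  \<open>t\<close> superior to \<open>s\<close>, and the assumption gives that rule a false
  antecedent. Every other instance fails on a rule atom.\<close>

lemma Defeated_F_if:
  assumes "3 \<le> n" "s \<in> rules_for D (compl q)"
    and "\<forall>t \<in> supportive_rules_for D q. (\<exists>a \<in> ante t. K n (Defeasibly a) = F) \<or> (t, s) \<notin> superior D"
  shows "K (Suc n) (Defeated (label s) (compl q)) = F"
proof -
  have "(\<exists>v \<in> set vs. K n (Defeasibly v) = F)"
    if sup: "\<exists>r' s'. (r', s') \<in> superior D \<and> label r' = l \<and> label s' = label s"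
      and has: "has_rule {StrictRule, DefeasibleRule} l q vs" for l vs
  proof -
    obtain t where t: "t \<in> supportive_rules_for D q" "label t = l" "ante t = set vs"
      using has_rule_supportive[OF has] by blast
    then have "(t, s) \<in> superior D"
      using sup superior_labels[OF supportive_rules_for[OF t(1)] assms(2)] by simp
    then show ?thesis using t(1,3) assms(3) by blast
  qed
  then show ?thesis
    unfolding K_Suc_Defeated rule_atoms_settled[OF assms(1)] by (metis (full_types))
qed

lemma Overruled_T_if:
  assumes "3 \<le> n" "l \<in> labels D" "s \<in> rules_for D (compl q)"
    and "\<forall>a \<in> ante s. K n (Defeasibly a) = T" "K n (Defeated (label s) (compl q)) = F"
  shows "K (Suc n) (Overruled l q) = T"
proof -
  have "has_rule UNIV (label s) (compl q) (lst s)"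
    by (rule any_has_rule[OF assms(3)])
  then show ?thesis
    unfolding K_Suc_Overruled rule_atoms_settled[OF assms(1)]
    using assms has_rule_in_program compl_in_literals set_lst_for(3)[OF assms(3)] by metis
qed

lemma Overruled_F_if:
  assumes "3 \<le> n"
    and "\<forall>s \<in> rules_for D (compl q). (\<exists>a \<in> ante s. K n (Defeasibly a) = F) \<or>
      K n (Defeated (label s) (compl q)) = T"
  shows "K (Suc n) (Overruled l q) = F"
  unfolding K_Suc_Overruled rule_atoms_settled[OF assms(1)]
  using assms(2) has_rule_any by (metis (full_types))

lemma Defeasibly_T_if_Definitely:
  assumes "3 \<le> n" "K n (Definitely q) = T"
  shows "K (Suc n) (Defeasibly q) = T"
proof (cases n)
  case (Suc m)
  \<comment> \<open>A true atom is the head of some clause, and only literals of the theory supply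
    clauses for \<open>Definitely\<close>.\<close>
  then have "q \<in> literals D" using assms(2) K_Suc_Definitely(1) by blast
  then show ?thesis using assms(2) K_Suc_Defeasibly(1) by blast
qed (use assms(1) in simp)

lemma Defeasibly_T_if:
  assumes "3 \<le> n" "r \<in> supportive_rules_for D q" "\<forall>a \<in> ante r. K n (Defeasibly a) = T"
    and "K n (Definitely (compl q)) = F" "K n (Overruled (label r) q) = F"
  shows "K (Suc n) (Defeasibly q) = T"
proof -
  have "has_rule {StrictRule, DefeasibleRule} (label r) q (lst r)"
    by (rule supportive_has_rule[OF assms(2)])
  then show ?thesis
    unfolding K_Suc_Defeasibly rule_atoms_settled[OF assms(1)]
    using assms(3-5) has_rule_in_program set_lst_for(2)[OF assms(2)] by metis
qed

lemma Defeasibly_F_if: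
  assumes "3 \<le> n" "K n (Definitely q) = F"
    and "\<And>r. r \<in> supportive_rules_for D q \<Longrightarrow> K n (Definitely (compl q)) = T \<or>
      (\<exists>a \<in> ante r. K n (Defeasibly a) = F) \<or> K n (Overruled (label r) q) = T"
  shows "K (Suc n) (Defeasibly q) = F"
  unfolding K_Suc_Defeasibly rule_atoms_settled[OF assms(1)]
  using assms(2,3) has_rule_supportive by (metis (full_types))

lemma justified_imp_holds:
  assumes "3 \<le> n" "justified D {L. holds (K n) L} L"
  shows "holds (K (n + 3)) L"
proof -
  have n: "n + 3 = Suc (Suc (Suc n))" "3 \<le> Suc n" "3 \<le> Suc (Suc n)" using assms(1) by simp_all
  show ?thesis
  proof (cases L)
    case (PlusDelta q)
    then have "K (Suc n) (Definitely q) = T"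
      using assms Definitely_T_if[OF assms(1)] by simp
    then show ?thesis unfolding PlusDelta n by (simp add: K_up)
  next
    case (MinusDelta q)
    then have "K (Suc n) (Definitely q) = F"
      using assms Definitely_F_if[OF assms(1)] by simp
    then show ?thesis unfolding MinusDelta n by (simp add: K_up)
  next
    case (PlusPartial q)
    show ?thesis
    proof (cases "K n (Definitely q) = T")
      case True
      then show ?thesis
        using Defeasibly_T_if_Definitely[OF assms(1)] unfolding PlusPartial n by (simp add: K_up)
    next
      case False
      then obtain r where r: "r \<in> supportive_rules_for D q" "\<forall>a \<in> ante r. K n (Defeasibly a) = T"
        and Def: "K n (Definitely (compl q)) = F"
        and att: "\<forall>s \<in> rules_for D (compl q). (\<exists>a \<in> ante s. K n (Defeasibly a) = F) \<or>
          (\<exists>t \<in> supportive_rules_for D q. (t, s) \<in> superior D \<and>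
            (\<forall>a \<in> ante t. K n (Defeasibly a) = T))"
        using assms(2) unfolding PlusPartial by auto
      \<comment> \<open>At stage \<open>n + 1\<close> every attacker is either inapplicable or
        defeated. Then \<open>Overruled\<close> is false at stage \<open>n + 2\<close>, and
        \<open>r\<close> makes \<open>Defeasibly q\<close> true at stage
        \<open>n + 3\<close>.\<close>
      have "\<forall>s \<in> rules_for D (compl q). (\<exists>a \<in> ante s. K (Suc n) (Defeasibly a) = F) \<or>
          K (Suc n) (Defeated (label s) (compl q)) = T"
        using att K_up(2) Defeated_T_if[OF assms(1)] by meson
      then have "K (Suc (Suc n)) (Overruled (label r) q) = F"
        by (rule Overruled_F_if[OF n(2)])
      then show ?thesis
        using Defeasibly_T_if[OF n(3) r(1)] r(2) Def unfolding PlusPartial n by (simp add: K_up)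
    qed
  next
    case (MinusPartial q)
    \<comment> \<open>The alternatives in the condition for \<open>-\<partial>\<close> are the ways
      to falsify the clause instance for \<open>r\<close>. They are compared at stage
      \<open>n + 2\<close>, the earliest at which an undefeated attacker has made
      \<open>Overruled\<close> true.\<close>
    have "K (Suc (Suc n)) (Definitely (compl q)) = T \<or>
        (\<exists>a \<in> ante r. K (Suc (Suc n)) (Defeasibly a) = F) \<or> K (Suc (Suc n)) (Overruled (label r) q) = T"
      if r: "r \<in> supportive_rules_for D q" for r
    proof -
      consider "\<exists>a \<in> ante r. K n (Defeasibly a) = F"
        | "K n (Definitely (compl q)) = T"
        | s where "s \<in> rules_for D (compl q)" "\<forall>a \<in> ante s. K n (Defeasibly a) = T"
          "\<forall>t \<in> supportive_rules_for D q.
            (\<exists>a \<in> ante t. K n (Defeasibly a) = F) \<or> (t, s) \<notin> superior D"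
        using assms(2) r unfolding MinusPartial by auto
      then show ?thesis
      proof cases
        case 1
        then show ?thesis by (blast intro: K_up)
      next
        case 2
        then show ?thesis by (simp add: K_up)
      next
        case 3
        have "K (Suc n) (Defeated (label s) (compl q)) = F"
          by (rule Defeated_F_if[OF assms(1) 3(1,3)])
        moreover have "label r \<in> labels D"
          using supportive_has_rule[OF r] has_rule_in_program by blast
        ultimately show ?thesis
          using Overruled_T_if[OF n(2) _ 3(1)] 3(2) by (simp add: K_up)
      qed
    qed
    moreover have "K n (Definitely q) = F" using assms(2) MinusPartial by simp
    ultimately show ?thesis
      using Defeasibly_F_if[OF n(3)] unfolding MinusPartial n by (simp add: K_up)
  qed
qed

text \<open>Each member of the derivation costs at most three further stages, so a finite derivation
  is matched by a finite stage. Starting at 3 keeps the rule atoms settled throughout.\<close>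

lemma derivation_holds:
  "derivation D P \<Longrightarrow> \<exists>n \<ge> 3. \<forall>L \<in> set P. holds (K n) L"
proof (induction P rule: rev_induct)
  case (snoc L P)
  then obtain n where n: "3 \<le> n" "\<forall>L \<in> set P. holds (K n) L"
    by (auto simp: derivation_snoc)
  have "justified D {L. holds (K n) L} L"
    using snoc.prems n(2) by (auto intro!: justified_mono[of D "set P"] simp: derivation_snoc)
  then have "holds (K (n + 3)) L" by (rule justified_imp_holds[OF n(1)])
  moreover have "\<forall>L \<in> set P. holds (K (n + 3)) L" using n(2) holds_mono by fastforce
  ultimately show ?case using n(1) by (intro exI[of _ "n + 3"]) simp
qed auto

lemma derives_iff_holds: "D \<turnstile> L \<longleftrightarrow> (\<exists>n. holds (K n) L)"
  using derivation_holds holds_imp_derives unfolding derives_def by blast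

end

theorem theorem5p4:
  fixes D :: "('l, 'a) dtheory"
    and lst :: "('l, 'a) rule \<Rightarrow> 'a lit list"
    and p :: "'a lit"
  assumes "defeasible_theory D"
    and "lists_antecedents D lst"
  shows "(D \<turnstile> +\<Delta> p \<longleftrightarrow> program D lst \<Turnstile>\<^sub>K Atom (Definitely p)) \<and>
         (D \<turnstile> -\<Delta> p \<longleftrightarrow> program D lst \<Turnstile>\<^sub>K Not (Atom (Definitely p))) \<and>
         (D \<turnstile> +\<partial> p \<longleftrightarrow> program D lst \<Turnstile>\<^sub>K Atom (Defeasibly p)) \<and>
         (D \<turnstile> -\<partial> p \<longleftrightarrow> program D lst \<Turnstile>\<^sub>K Not (Atom (Defeasibly p)))"
proof -
  interpret listed_theory D lst using assms by unfold_locales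
  show ?thesis
    by (simp add: derives_iff_holds kunen_models_def eval_Atom eval_Not_T)
qed

end
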